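(* Let $f(x)\in\mathbb{Z}[x]$ be monic, irreducible, and monogenic, of degree $n$. Let $c\in\mathbb{Z}$ and define $F(x)=x^n f\left(x+\frac1x+c\right)$. Suppose that $\beta$ is a root of $F(x)$. If $f(c+2)f(c-2)$ is squarefree and $F(x)$ is irreducible, then $\mathcal{O}_{\mathbb{Q}(\beta)}=\mathbb{Z}[\beta]$; in particular $\mathbb{Q}(\beta)$ is monogenic.
   Context: A number field is monogenic if its ring of integers is generated as a ring over $\mathbb{Z}$ by a single element. A monic irreducible polynomial $f\in\mathbb{Z}[x]$ is called monogenic if, for a root $\alpha$ of $f$ and $K=\mathbb{Q}(\alpha)$, one has $\mathrm{disc}(f)=\mathrm{disc}(K)$; equivalently, $\mathcal{O}_K=\mathbb{Z}[\alpha]$. Here $\mathcal{O}_K$ denotes the ring of integers of the number field $K$. An integer is squarefree if it is not divisible by the square of any prime (in particular $0$ is not squarefree). Irreducible means irreducible over $\mathbb{Q}$. $F$ is a monic polynomial in $\mathbb{Z}[x]$ of degree $2n$. *)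

theory Defs
  imports
    Complex_Main
    "HOL-Library.FuncSet"
    "HOL-Computational_Algebra.Computational_Algebra"
    "Jordan_Normal_Form.Char_Poly"
begin

text \<open>Number fields are realised as subfields of \<open>complex\<close>.\<close>

definition complex_subfield :: "complex set \<Rightarrow> bool" where
  "complex_subfield K \<longleftrightarrow> 0 \<in> K \<and> 1 \<in> K \<and>
     (\<forall>x\<in>K. \<forall>y\<in>K. x - y \<in> K \<and> x * y \<in> K) \<and> (\<forall>x\<in>K. inverse x \<in> K)"

definition number_field :: "complex set \<Rightarrow> bool" where
  "number_field K \<longleftrightarrow> complex_subfield K \<and>
     (\<exists>bs. set bs \<subseteq> K \<and>
        (\<forall>x\<in>K. \<exists>q :: nat \<Rightarrow> rat. x = (\<Sum>i<length bs. of_rat (q i) * bs ! i)))"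

definition rat_adjoin :: "complex \<Rightarrow> complex set" where
  "rat_adjoin \<alpha> = \<Inter> {K. complex_subfield K \<and> \<alpha> \<in> K}"

definition int_adjoin :: "complex \<Rightarrow> complex set" where
  "int_adjoin \<alpha> = {poly (map_poly of_int p) \<alpha> |p :: int poly. True}"

definition ring_of_integers :: "complex set \<Rightarrow> complex set" where
  "ring_of_integers K = {x \<in> K. algebraic_int x}"

definition monogenic_field :: "complex set \<Rightarrow> bool" where
  "monogenic_field K \<longleftrightarrow> number_field K \<and> (\<exists>\<theta>. ring_of_integers K = int_adjoin \<theta>)"

text \<open>The embeddings are made extensional, so that each embedding of \<open>K\<close> into \<open>complex\<close>
  is counted once in the trace.\<close>

definition embeddings :: "complex set \<Rightarrow> (complex \<Rightarrow> complex) set" where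
  "embeddings K = {\<sigma> \<in> extensional K. \<sigma> 1 = 1 \<and>
     (\<forall>x\<in>K. \<forall>y\<in>K. \<sigma> (x + y) = \<sigma> x + \<sigma> y \<and> \<sigma> (x * y) = \<sigma> x * \<sigma> y)}"

definition field_trace :: "complex set \<Rightarrow> complex \<Rightarrow> complex" where
  "field_trace K x = (\<Sum>\<sigma>\<in>embeddings K. \<sigma> x)"

definition integral_basis :: "complex set \<Rightarrow> complex list \<Rightarrow> bool" where
  "integral_basis K ws \<longleftrightarrow> set ws \<subseteq> ring_of_integers K \<and>
     (\<forall>x\<in>ring_of_integers K. \<exists>!a :: int list.
        length a = length ws \<and> x = (\<Sum>i<length ws. of_int (a ! i) * ws ! i))"

text \<open>\<open>d = disc(K)\<close> is a relation. It is functional for a number field, since an integral basis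
  exists and any two are related by an integer matrix of determinant \<open>1\<close> or \<open>-1\<close>.\<close>

definition has_field_disc :: "complex set \<Rightarrow> complex \<Rightarrow> bool" where
  "has_field_disc K d \<longleftrightarrow> (\<exists>ws. integral_basis K ws \<and>
     d = det (mat (length ws) (length ws) (\<lambda>(i, j). field_trace K (ws ! i * ws ! j))))"

text \<open>The roots are listed with multiplicity. The value does not depend on the chosen order.\<close>

definition poly_disc :: "int poly \<Rightarrow> complex" where
  "poly_disc f =
     (let rs = (SOME rs. mset rs = proots (map_poly of_int f :: complex poly))
      in of_int (lead_coeff f) ^ (2 * degree f - 2) *
         (\<Prod>j<length rs. \<Prod>i<j. (rs ! i - rs ! j)\<^sup>2))"

definition irreducible_over_rat :: "int poly \<Rightarrow> bool" where
  "irreducible_over_rat f \<longleftrightarrow> irreducible (map_poly of_int f :: rat poly)"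

definition monogenic_poly :: "int poly \<Rightarrow> bool" where
  "monogenic_poly f \<longleftrightarrow> lead_coeff f = 1 \<and> irreducible_over_rat f \<and>
     (\<forall>\<alpha>::complex. poly (map_poly of_int f) \<alpha> = 0 \<longrightarrow>
        has_field_disc (rat_adjoin \<alpha>) (poly_disc f))"

text \<open>The polynomial \<open>x\<^sup>n f(x + 1/x + c)\<close> with \<open>n = deg f\<close>, with the powers of \<open>x\<close>
  distributed over the terms of \<open>f\<close>; see the lemma below.\<close>

definition reciprocal_lift :: "int \<Rightarrow> int poly \<Rightarrow> int poly" where
  "reciprocal_lift c f =
     (\<Sum>i\<le>degree f. Polynomial.smult (coeff f i) (monom 1 (degree f - i) * [:1, c, 1:] ^ i))"

lemma poly_reciprocal_lift:
  fixes x :: "'a :: field_char_0"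
  assumes "x \<noteq> 0"
  shows "poly (map_poly of_int (reciprocal_lift c f)) x =
           x ^ degree f * poly (map_poly of_int f) (x + 1 / x + of_int c)"
proof -
  have *: "x ^ (degree f - i) * (1 + x * (of_int c + x)) ^ i =
      x ^ degree f * (x + 1 / x + of_int c) ^ i" if "i \<le> degree f" for i
  proof -
    have "1 + x * (of_int c + x) = x * (x + 1 / x + of_int c)"
      using assms by (simp add: field_simps)
    then have "x ^ (degree f - i) * (1 + x * (of_int c + x)) ^ i =
        x ^ (degree f - i) * x ^ i * (x + 1 / x + of_int c) ^ i"
      by (simp only: power_mult_distrib mult.assoc)
    also have "x ^ (degree f - i) * x ^ i = x ^ degree f"
      using that by (simp flip: power_add)
    finally show ?thesis .
  qed
  have "poly (map_poly of_int (reciprocal_lift c f)) x =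
      (\<Sum>i\<le>degree f. of_int (coeff f i) *
         (x ^ (degree f - i) * (1 + x * (of_int c + x)) ^ i))"
    unfolding reciprocal_lift_def
    by (simp add: hom_distribs poly_hom.hom_sum poly_monom)
  also have "\<dots> = (\<Sum>i\<le>degree f. of_int (coeff f i) *
         (x ^ degree f * (x + 1 / x + of_int c) ^ i))"
    by (intro sum.cong refl) (simp add: *)
  also have "\<dots> = x ^ degree f * poly (map_poly of_int f) (x + 1 / x + of_int c)"
    by (simp add: poly_altdef sum_distrib_left mult_ac degree_map_poly coeff_map_poly)
  finally show ?thesis .
qed

end

theory Submission
  imports Defs "HOL-Computational_Algebra.Field_as_Ring"
begin

text \<open>
  Put \<open>\<alpha> = \<beta> + 1/\<beta> + c\<close>, a root of \<open>f\<close>. Two facts give the theorem.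

  First, monogenicity of \<open>f\<close> says that the integers of \<open>\<rat>(\<alpha>)\<close> are exactly \<open>\<int>[\<alpha>]\<close>. The
  hypothesis is an equality of discriminants. Expressing the powers of \<open>\<alpha>\<close> in an integral basis
  by an integer matrix \<open>M\<close> multiplies the discriminant by \<open>(det M)\<^sup>2\<close>, and since \<open>f\<close> has distinct
  roots the discriminant is nonzero; so \<open>det M = \<plusminus>1\<close> and \<open>M\<close> can be inverted over the integers
  (lemma \<open>ring_of_integers_if_monogenic_poly\<close>).

  Secondly, \<open>\<rat>(\<beta>)\<close> is the quadratic extension of \<open>\<rat>(\<alpha>)\<close> in which \<open>\<beta>\<close> and \<open>1/\<beta>\<close> are
  conjugate, and the relative discriminant of \<open>\<beta>\<close> is
  \<open>\<Delta> = (\<beta> - 1/\<beta>)\<^sup>2 = (\<alpha> - (c + 2)) (\<alpha> - (c - 2))\<close>, whose norm is \<open>f(c + 2) f(c - 2)\<close> up to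
  sign. Let \<open>x = U + V \<beta>\<close> be integral with \<open>U, V \<in> \<rat>(\<alpha>)\<close> and let \<open>x' = U + V/\<beta>\<close> be its conjugate.
  Then \<open>V \<Delta> = (x - x') (\<beta> - 1/\<beta>)\<close> and \<open>V\<^sup>2 \<Delta> = (x - x')\<^sup>2\<close> are integral, hence in \<open>\<int>[\<alpha>]\<close>. Thus
  \<open>w = V \<Delta>\<close> is an element of \<open>\<int>[\<alpha>]\<close> whose square is divisible by \<open>\<Delta>\<close>. The ring
  \<open>\<int>[\<alpha>]/(\<Delta>)\<close> has squarefree order, so it is reduced, and \<open>\<Delta>\<close> divides \<open>w\<close>
  (lemma \<open>quadratic_dvd_if_dvd_square\<close>). This means \<open>V \<in> \<int>[\<alpha>]\<close>; then \<open>U = x - V \<beta>\<close> is integral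
  too, so \<open>U \<in> \<int>[\<alpha>]\<close>. Finally \<open>F\<close> has constant coefficient \<open>1\<close>, so \<open>1/\<beta>\<close>, and with it
  \<open>\<alpha>\<close>, lies in \<open>\<int>[\<beta>]\<close>, whence \<open>x \<in> \<int>[\<beta>]\<close>.

  Elements of \<open>\<rat>(\<alpha>)\<close> are handled throughout as values of rational polynomials at \<open>\<alpha>\<close>;
  conjugation is then evaluation of the same polynomial at another root of the irreducible
  polynomial (lemma \<open>rpoly_eq_at_conjugate\<close>).
\<close>

abbreviation ipoly :: "int poly \<Rightarrow> complex \<Rightarrow> complex" where
  "ipoly p \<equiv> poly (map_poly of_int p)"

abbreviation rpoly :: "rat poly \<Rightarrow> complex \<Rightarrow> complex" where
  "rpoly p \<equiv> poly (map_poly of_rat p)"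

section \<open>Algebraic integers form a ring\<close>

interpretation int_mod: Modules.module "\<lambda>(k::int) (x::complex). of_int k * x"
  by unfold_locales (auto simp: algebra_simps)

text \<open>The characteristic polynomial of an integer matrix is monic with integer coefficients.\<close>

lemma algebraic_int_eigenvalue:
  assumes M: "M \<in> carrier_mat n n" and v: "v \<in> carrier_vec n" "v \<noteq> 0\<^sub>v n"
    and eq: "map_mat of_int M *\<^sub>v v = x \<cdot>\<^sub>v v"
  shows "algebraic_int (x :: complex)"
proof -
  let ?C = "map_mat of_int M :: complex mat"
  have C: "?C \<in> carrier_mat n n" using M by simp
  have "eigenvalue ?C x"
    unfolding eigenvalue_def eigenvector_def using v eq M by auto
  then have "poly (char_poly ?C) x = 0" using eigenvalue_root_char_poly[OF C] by simp
  then have "poly (map_poly of_int (char_poly M)) x = 0"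
    using of_int_hom.char_poly_hom[OF M] by metis
  moreover have "lead_coeff (char_poly M) = 1"
    using degree_monic_char_poly[OF M] by simp
  ultimately show ?thesis using algebraic_int_altdef_ipoly by blast
qed

text \<open>Multiplication by \<open>x\<close> acts on the generators \<open>S\<close> through an integer matrix, and the vector
  of generators is an eigenvector of that matrix with eigenvalue \<open>x\<close>.\<close>

lemma algebraic_int_if_stable_span:
  assumes fin: "finite S" and nz: "s0 \<in> S" "s0 \<noteq> 0"
    and stable: "\<And>s. s \<in> S \<Longrightarrow> x * s \<in> int_mod.span S"
  shows "algebraic_int (x :: complex)"
proof -
  obtain ss where ss: "set ss = S" "distinct ss" using finite_distinct_list[OF fin] by blast
  define n where "n = length ss"
  have "\<exists>k. x * s = (\<Sum>t\<in>S. of_int (k t) * t)" if "s \<in> S" for s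
    using stable[OF that] int_mod.span_finite[OF fin] by auto
  then obtain k where k: "\<And>s. s \<in> S \<Longrightarrow> x * s = (\<Sum>t\<in>S. of_int (k s t) * t)" by metis
  define M where "M = mat n n (\<lambda>(i, j). k (ss ! i) (ss ! j))"
  define v where "v = vec n (\<lambda>i. ss ! i)"
  have "map_mat of_int M *\<^sub>v v = x \<cdot>\<^sub>v v"
  proof (rule eq_vecI)
    fix i assume "i < dim_vec (x \<cdot>\<^sub>v v)"
    then have i: "i < n" by (simp add: v_def)
    have "(map_mat of_int M *\<^sub>v v) $ i = (\<Sum>j<n. of_int (k (ss ! i) (ss ! j)) * ss ! j)"
      using i by (simp add: M_def v_def scalar_prod_def atLeast0LessThan)
    also have "\<dots> = (\<Sum>t\<in>S. of_int (k (ss ! i) t) * t)"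
      unfolding n_def
      by (rule sum.reindex_bij_betw[OF bij_betw_nth, OF ss(2) refl ss(1)[symmetric]])
    also have "\<dots> = x * ss ! i" using k[of "ss ! i"] i ss(1) n_def by auto
    finally show "(map_mat of_int M *\<^sub>v v) $ i = (x \<cdot>\<^sub>v v) $ i" using i by (simp add: v_def)
  qed (simp add: M_def v_def)
  moreover have "v \<noteq> 0\<^sub>v n"
  proof
    assume "v = 0\<^sub>v n"
    moreover obtain i where "i < n" "ss ! i = s0" using nz(1) ss(1) n_def by (metis in_set_conv_nth)
    ultimately show False using nz(2) by (metis v_def index_vec index_zero_vec(1))
  qed
  ultimately show ?thesis
    by (intro algebraic_int_eigenvalue[of M n v]) (auto simp: M_def v_def)
qed

lemma degree_pos_if_monic_root:
  assumes "ipoly p x = 0" "lead_coeff p = 1"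
  shows "degree p > 0"
proof (rule ccontr)
  assume "\<not> degree p > 0"
  then obtain a where "p = [:a:]" using degree_eq_zeroE by blast
  then show False using assms by simp
qed

lemma monic_root_power:
  assumes "ipoly p x = 0" "lead_coeff p = 1"
  shows "x ^ degree p = (\<Sum>i<degree p. of_int (- coeff p i) * x ^ i)"
proof -
  have "0 = (\<Sum>i\<le>degree p. of_int (coeff p i) * x ^ i)"
    using assms(1) by (simp add: poly_altdef)
  also have "\<dots> = (\<Sum>i<degree p. of_int (coeff p i) * x ^ i) + x ^ degree p"
    using assms(2) by (simp add: lessThan_Suc_atMost[symmetric])
  finally show ?thesis by (simp add: sum_negf eq_neg_iff_add_eq_0 add.commute)
qed

text \<open>The products \<open>x\<^sup>i y\<^sup>j\<close> below the degrees of monic equations for \<open>x\<close> and \<open>y\<close> generate a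
  module stable under both numbers, hence also under their sum and product.\<close>

lemma algebraic_int_common_module:
  assumes "algebraic_int (x :: complex)" "algebraic_int y"
  obtains S where "finite S" "1 \<in> S"
    "\<And>t. t \<in> int_mod.span S \<Longrightarrow> x * t \<in> int_mod.span S"
    "\<And>t. t \<in> int_mod.span S \<Longrightarrow> y * t \<in> int_mod.span S"
proof -
  from assms obtain p q where p: "ipoly p x = 0" "lead_coeff p = 1"
    and q: "ipoly q y = 0" "lead_coeff q = 1"
    unfolding algebraic_int_altdef_ipoly by blast
  define m n where "m = degree p" and "n = degree q"
  define S where "S = (\<lambda>(i, j). x ^ i * y ^ j) ` ({..<m} \<times> {..<n})"
  have mon: "x ^ i * y ^ j \<in> int_mod.span S" if "i < m" "j < n" for i j
    using that by (intro int_mod.span_base) (auto simp: S_def)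
  have "m \<noteq> 0" "n \<noteq> 0" using degree_pos_if_monic_root p q by (auto simp: m_def n_def)
  have "1 \<in> S" unfolding S_def using \<open>m \<noteq> 0\<close> \<open>n \<noteq> 0\<close> by (intro image_eqI[of _ _ "(0, 0)"]) auto
  have xS: "x * t \<in> int_mod.span S" if "t \<in> S" for t
  proof -
    from that obtain i j where t: "t = x ^ i * y ^ j" "i < m" "j < n" by (auto simp: S_def)
    show ?thesis
    proof (cases "Suc i = m")
      case True
      have "x * t = x ^ m * y ^ j" by (simp add: t flip: True)
      also have "\<dots> = (\<Sum>l<m. of_int (- coeff p l) * (x ^ l * y ^ j))"
        unfolding m_def monic_root_power[OF p] sum_distrib_right by (simp only: mult_ac)
      also have "\<dots> \<in> int_mod.span S"
        using mon t(3) by (intro int_mod.span_sum int_mod.span_scale) auto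
      finally show ?thesis .
    next
      case False
      then show ?thesis using mon[of "Suc i" j] t by (simp add: mult_ac)
    qed
  qed
  have yS: "y * t \<in> int_mod.span S" if "t \<in> S" for t
  proof -
    from that obtain i j where t: "t = x ^ i * y ^ j" "i < m" "j < n" by (auto simp: S_def)
    show ?thesis
    proof (cases "Suc j = n")
      case True
      have "y * t = x ^ i * y ^ n" by (simp add: t flip: True)
      also have "\<dots> = (\<Sum>l<n. of_int (- coeff q l) * (x ^ i * y ^ l))"
        unfolding n_def monic_root_power[OF q] sum_distrib_left by (simp only: mult_ac)
      also have "\<dots> \<in> int_mod.span S"
        using mon t(2) by (intro int_mod.span_sum int_mod.span_scale) auto
      finally show ?thesis .
    next
      case False
      then show ?thesis using mon[of i "Suc j"] t by (simp add: mult_ac)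
    qed
  qed
  have ext: "z * t \<in> int_mod.span S"
    if "\<And>t. t \<in> S \<Longrightarrow> z * t \<in> int_mod.span S" "t \<in> int_mod.span S" for z t
    using that(2)
  proof (induction rule: int_mod.span_induct_alt)
    case base
    show ?case using int_mod.span_zero[of S] by simp
  next
    case (step k a b)
    have "z * (of_int k * a + b) = of_int k * (z * a) + z * b" by (simp add: algebra_simps)
    then show ?case
      using step that(1) by (auto intro!: int_mod.span_add int_mod.span_scale)
  qed
  show ?thesis
    by (rule that[of S]) (use \<open>1 \<in> S\<close> ext xS yS in \<open>auto simp: S_def\<close>)
qed

lemma algebraic_int_add:
  assumes "algebraic_int (x :: complex)" "algebraic_int y"
  shows "algebraic_int (x + y)"
proof -
  obtain S where "finite S" "1 \<in> S"
    "\<And>t. t \<in> int_mod.span S \<Longrightarrow> x * t \<in> int_mod.span S"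
    "\<And>t. t \<in> int_mod.span S \<Longrightarrow> y * t \<in> int_mod.span S"
    using algebraic_int_common_module[OF assms] by metis
  then show ?thesis
    by (intro algebraic_int_if_stable_span[of S 1])
      (auto simp: distrib_right int_mod.span_base intro!: int_mod.span_add)
qed

lemma algebraic_int_mult:
  assumes "algebraic_int (x :: complex)" "algebraic_int y"
  shows "algebraic_int (x * y)"
proof -
  obtain S where "finite S" "1 \<in> S"
    "\<And>t. t \<in> int_mod.span S \<Longrightarrow> x * t \<in> int_mod.span S"
    "\<And>t. t \<in> int_mod.span S \<Longrightarrow> y * t \<in> int_mod.span S"
    using algebraic_int_common_module[OF assms] by metis
  then show ?thesis
    by (intro algebraic_int_if_stable_span[of S 1])
      (auto simp: mult.assoc int_mod.span_base)
qed

lemma algebraic_int_diff: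
  "algebraic_int (x :: complex) \<Longrightarrow> algebraic_int y \<Longrightarrow> algebraic_int (x - y)"
  using algebraic_int_add[of x "- y"] by auto

lemma algebraic_int_ipoly:
  assumes "algebraic_int (x :: complex)"
  shows "algebraic_int (ipoly p x)"
proof (induction p)
  case (pCons a p)
  have "algebraic_int (of_int a :: complex)" by (intro int_imp_algebraic_int) auto
  then show ?case using pCons assms by (auto simp: hom_distribs intro!: algebraic_int_add algebraic_int_mult)
qed auto

section \<open>Simple extensions of the rationals inside the complex numbers\<close>

lemma rpoly_of_int_poly: "rpoly (map_poly of_int p) x = ipoly p x"
  by (simp add: map_poly_map_poly o_def)

interpretation of_rat_poly_hom: map_poly_idom_hom "of_rat :: rat \<Rightarrow> complex" ..

lemma rpoly_simps [simp]:
  "rpoly 0 x = 0" "rpoly 1 x = 1"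
  "rpoly (p + q) x = rpoly p x + rpoly q x"
  "rpoly (p - q) x = rpoly p x - rpoly q x"
  "rpoly (p * q) x = rpoly p x * rpoly q x"
  "rpoly (pCons a p) x = of_rat a + x * rpoly p x"
  "rpoly (monom 1 i) x = x ^ i"
  "rpoly (Polynomial.smult a p) x = of_rat a * rpoly p x"
  by (simp_all add: hom_distribs of_rat_hom.map_poly_hom_monom poly_monom)

lemma rpoly_pcompose: "rpoly (p \<circ>\<^sub>p q) x = rpoly p (rpoly q x)"
  by (induction p) (simp_all add: pcompose_pCons)

lemma rpoly_sum: "rpoly (sum p A) x = (\<Sum>a\<in>A. rpoly (p a) x)"
  by (induction A rule: infinite_finite_induct) auto

lemma irreducible_bezout:
  fixes P q :: "rat poly"
  assumes "irreducible P" "\<not> P dvd q"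
  obtains u v where "u * P + v * q = 1"
proof -
  define g where "g = gcd P q"
  have "g dvd P" "g dvd q" by (simp_all add: g_def)
  then obtain e where e: "P = g * e" by blast
  have "\<not> e dvd 1"
  proof
    assume "e dvd 1"
    then have "P dvd g" unfolding e by (subst mult_unit_dvd_iff) auto
    then show False using \<open>g dvd q\<close> assms(2) dvd_trans by blast
  qed
  then have "g dvd 1" using assms(1) e irreducibleD by blast
  then have "gcd P q = 1" unfolding g_def by (simp only: is_unit_gcd_iff)
  then have "fst (bezout_coefficients P q) * P + snd (bezout_coefficients P q) * q = 1"
    by (simp add: bezout_coefficients_fst_snd)
  then show ?thesis by (rule that)
qed

text \<open>Otherwise a Bezout relation between \<open>P\<close> and \<open>q\<close>, evaluated at \<open>z\<close>, would read \<open>0 = 1\<close>.\<close>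

lemma irreducible_dvd_if_common_root:
  assumes "irreducible P" "rpoly P z = 0" "rpoly q z = 0"
  shows "P dvd q"
proof (rule ccontr)
  assume "\<not> P dvd q"
  then obtain u v where "u * P + v * q = 1" using irreducible_bezout[OF assms(1)] by blast
  then have "rpoly (u * P + v * q) z = 1" by (metis rpoly_simps(2))
  then show False using assms by simp
qed

text \<open>This makes the substitution of one root of \<open>P\<close> for another a well-defined map on
  \<open>\<rat>(\<alpha>)\<close>, whatever polynomial is chosen to represent an element.\<close>

lemma rpoly_eq_at_conjugate:
  assumes "irreducible P" "rpoly P \<alpha> = 0" "rpoly P r = 0" "rpoly p \<alpha> = rpoly q \<alpha>"
  shows "rpoly p r = rpoly q r"
proof -
  have "P dvd p - q"
    by (rule irreducible_dvd_if_common_root[OF assms(1,2)]) (use assms(4) in simp)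
  then obtain h where "p - q = P * h" by blast
  then have "rpoly (p - q) r = 0" using assms(3) by simp
  then show ?thesis by simp
qed

lemma subfield_of_rat:
  assumes K: "complex_subfield K"
  shows "of_rat q \<in> K"
proof -
  have sub: "x - y \<in> K" "x * y \<in> K" "inverse x \<in> K" if "x \<in> K" "y \<in> K" for x y
    using K that by (auto simp: complex_subfield_def)
  have "0 \<in> K" "1 \<in> K" using K by (auto simp: complex_subfield_def)
  have int: "of_int k \<in> K" for k
  proof (induction k rule: int_induct[of _ 0])
    case (step1 i)
    have "of_int i - (0 - 1) \<in> K" by (intro sub step1 \<open>0 \<in> K\<close> \<open>1 \<in> K\<close>)
    then show ?case by simp
  next
    case (step2 i)
    then show ?case using sub[OF step2(2) \<open>1 \<in> K\<close>] by simp
  qed (use \<open>0 \<in> K\<close> in simp)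
  obtain a b where "q = of_int a / of_int b" by (metis quotient_of_div surj_pair)
  then have "of_rat q = (of_int a / of_int b :: complex)" by (simp add: of_rat_divide)
  then show ?thesis using sub(2)[OF int sub(3)[OF int int]] by (simp add: divide_inverse)
qed

text \<open>The values of rational polynomials at \<open>\<alpha>\<close> are closed under inversion because a polynomial
  not vanishing at \<open>\<alpha>\<close> is invertible modulo \<open>P\<close>.\<close>

lemma rat_adjoin_eq:
  assumes P: "irreducible P" "rpoly P \<alpha> = 0"
  shows "rat_adjoin \<alpha> = range (\<lambda>p. rpoly p \<alpha>)"
proof
  have inv: "inverse (rpoly p \<alpha>) \<in> range (\<lambda>p. rpoly p \<alpha>)" for p
  proof (cases "rpoly p \<alpha> = 0")
    case True
    then have "inverse (rpoly p \<alpha>) = rpoly 0 \<alpha>" by simp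
    then show ?thesis by blast
  next
    case False
    then have "\<not> P dvd p" using P(2) by auto
    then obtain u v where "u * P + v * p = 1" using irreducible_bezout[OF P(1)] by blast
    then have "rpoly (u * P + v * p) \<alpha> = 1" by (metis rpoly_simps(2))
    then have "rpoly v \<alpha> * rpoly p \<alpha> = 1" using P(2) by simp
    then have "inverse (rpoly p \<alpha>) = rpoly v \<alpha>"
      using inverse_unique[of "rpoly p \<alpha>" "rpoly v \<alpha>"] by (simp add: mult.commute)
    then show ?thesis by blast
  qed
  have "complex_subfield (range (\<lambda>p. rpoly p \<alpha>))"
    unfolding complex_subfield_def
  proof (intro conjI ballI)
    show "0 \<in> range (\<lambda>p. rpoly p \<alpha>)" using rangeI[of "\<lambda>p. rpoly p \<alpha>" 0] by simp
    show "1 \<in> range (\<lambda>p. rpoly p \<alpha>)" using rangeI[of "\<lambda>p. rpoly p \<alpha>" 1] by simp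
  next
    fix x y assume "x \<in> range (\<lambda>p. rpoly p \<alpha>)" "y \<in> range (\<lambda>p. rpoly p \<alpha>)"
    then obtain p q where "x = rpoly p \<alpha>" "y = rpoly q \<alpha>" by blast
    then have "x - y = rpoly (p - q) \<alpha>" "x * y = rpoly (p * q) \<alpha>" by simp_all
    then show "x - y \<in> range (\<lambda>p. rpoly p \<alpha>)" "x * y \<in> range (\<lambda>p. rpoly p \<alpha>)" by blast+
  qed (use inv in blast)
  moreover have "\<alpha> = rpoly [:0, 1:] \<alpha>" by simp
  then have "\<alpha> \<in> range (\<lambda>p. rpoly p \<alpha>)" by blast
  ultimately show "rat_adjoin \<alpha> \<subseteq> range (\<lambda>p. rpoly p \<alpha>)" unfolding rat_adjoin_def by blast
  have "rpoly p \<alpha> \<in> K" if K: "complex_subfield K" "\<alpha> \<in> K" for K p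
  proof (induction p)
    case 0
    then show ?case using K(1) by (simp add: complex_subfield_def)
  next
    case (pCons a p)
    have cl: "x - y \<in> K" "x * y \<in> K" if "x \<in> K" "y \<in> K" for x y
      using K(1) that by (auto simp: complex_subfield_def)
    have "of_rat a - (0 - \<alpha> * rpoly p \<alpha>) \<in> K"
      by (intro cl subfield_of_rat K pCons) (use K in \<open>simp add: complex_subfield_def\<close>)
    then show ?case by simp
  qed
  then show "range (\<lambda>p. rpoly p \<alpha>) \<subseteq> rat_adjoin \<alpha>" unfolding rat_adjoin_def by blast
qed

lemma complex_subfield_rat_adjoin: "complex_subfield (rat_adjoin \<alpha>)"
  unfolding rat_adjoin_def complex_subfield_def by blast

text \<open>Reduction modulo \<open>P\<close> shows that the powers of \<open>\<alpha>\<close> below the degree of \<open>P\<close> span.\<close>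

lemma number_field_rat_adjoin:
  assumes P: "irreducible P" "rpoly P \<alpha> = 0"
  shows "number_field (rat_adjoin \<alpha>)"
proof -
  have "P \<noteq> 0" using P(1) by auto
  define bs where "bs = map (\<lambda>i. \<alpha> ^ i) [0..<degree P]"
  have "\<alpha> ^ i \<in> rat_adjoin \<alpha>" for i
    unfolding rat_adjoin_eq[OF P] using rangeI[of "\<lambda>p. rpoly p \<alpha>" "monom 1 i"] by (simp add: poly_monom)
  then have "set bs \<subseteq> rat_adjoin \<alpha>" by (auto simp: bs_def)
  moreover have "\<exists>q. x = (\<Sum>i<length bs. of_rat (q i) * bs ! i)" if "x \<in> rat_adjoin \<alpha>" for x
  proof -
    from that obtain p where "x = rpoly p \<alpha>" unfolding rat_adjoin_eq[OF P] by blast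
    also have "\<dots> = rpoly (p div P * P + p mod P) \<alpha>" by simp
    also have "\<dots> = rpoly (p mod P) \<alpha>" by (simp only: rpoly_simps P(2) mult_zero_right add_0_left)
    also have "p mod P = (\<Sum>i<degree P. monom (coeff (p mod P) i) i)"
    proof (rule poly_eqI)
      fix j
      have "coeff (p mod P) j = 0" if "j \<ge> degree P"
        using degree_mod_less[of P p] \<open>P \<noteq> 0\<close> that by (auto simp: coeff_eq_0)
      then show "coeff (p mod P) j = coeff (\<Sum>i<degree P. monom (coeff (p mod P) i) i) j"
        by (auto simp: coeff_sum not_less)
    qed
    also have "rpoly \<dots> \<alpha> = (\<Sum>i<length bs. of_rat (coeff (p mod P) i) * bs ! i)"
      by (simp add: rpoly_sum of_rat_hom.map_poly_hom_monom poly_monom bs_def)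
    finally show ?thesis by blast
  qed
  ultimately show ?thesis
    unfolding number_field_def using complex_subfield_rat_adjoin by blast
qed

lemma int_adjoin_ipoly [intro, simp]: "ipoly p \<alpha> \<in> int_adjoin \<alpha>"
  by (auto simp: int_adjoin_def)

lemma int_adjoin_generator [intro, simp]: "\<alpha> \<in> int_adjoin \<alpha>"
  using int_adjoin_ipoly[of "[:0, 1:]" \<alpha>] by simp

lemma int_adjoin_of_int [intro, simp]: "of_int k \<in> int_adjoin \<alpha>"
  using int_adjoin_ipoly[of "[:k:]" \<alpha>] by (simp add: of_int_hom.map_poly_pCons_hom)

lemma int_adjoin_closed:
  assumes "x \<in> int_adjoin \<alpha>" "y \<in> int_adjoin \<alpha>"
  shows "x + y \<in> int_adjoin \<alpha>" "x - y \<in> int_adjoin \<alpha>" "x * y \<in> int_adjoin \<alpha>"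
proof -
  from assms obtain p q where x: "x = ipoly p \<alpha>" "y = ipoly q \<alpha>"
    by (auto simp: int_adjoin_def)
  have "x + y = ipoly (p + q) \<alpha>" "x - y = ipoly (p - q) \<alpha>" "x * y = ipoly (p * q) \<alpha>"
    by (simp_all add: x hom_distribs)
  then show "x + y \<in> int_adjoin \<alpha>" "x - y \<in> int_adjoin \<alpha>" "x * y \<in> int_adjoin \<alpha>"
    by simp_all
qed

lemma int_adjoin_sum:
  "(\<And>i. i \<in> I \<Longrightarrow> g i \<in> int_adjoin \<alpha>) \<Longrightarrow> sum g I \<in> int_adjoin \<alpha>"
proof (induction I rule: infinite_finite_induct)
  case (insert i I)
  then show ?case by (auto intro: int_adjoin_closed)
qed (use int_adjoin_of_int[of 0 \<alpha>] in simp_all)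

lemma int_adjoin_power: "x \<in> int_adjoin \<alpha> \<Longrightarrow> x ^ n \<in> int_adjoin \<alpha>"
  by (induction n) (use int_adjoin_of_int[of 1 \<alpha>] in \<open>auto intro: int_adjoin_closed\<close>)

lemma int_adjoin_subset:
  assumes "\<alpha> \<in> int_adjoin \<beta>"
  shows "int_adjoin \<alpha> \<subseteq> int_adjoin \<beta>"
proof -
  have "ipoly p \<alpha> \<in> int_adjoin \<beta>" for p
    unfolding poly_altdef using assms
    by (auto intro!: int_adjoin_sum int_adjoin_closed int_adjoin_power)
  then show ?thesis by (auto simp: int_adjoin_def)
qed

lemma int_adjoin_subset_ring_of_integers:
  assumes "algebraic_int \<alpha>" "irreducible P" "rpoly P \<alpha> = 0"
  shows "int_adjoin \<alpha> \<subseteq> ring_of_integers (rat_adjoin \<alpha>)"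
proof
  fix x assume "x \<in> int_adjoin \<alpha>"
  then obtain p where x: "x = ipoly p \<alpha>" by (auto simp: int_adjoin_def)
  then have "x = rpoly (map_poly of_int p) \<alpha>" by (simp add: rpoly_of_int_poly)
  then show "x \<in> ring_of_integers (rat_adjoin \<alpha>)"
    using algebraic_int_ipoly[OF assms(1), of p] rat_adjoin_eq[OF assms(2,3)]
    by (auto simp: ring_of_integers_def x)
qed

section \<open>Conjugates and traces\<close>

text \<open>A multiple root would be a root of the derivative, so \<open>P\<close> would divide the nonzero polynomial
  \<open>P'\<close> of smaller degree.\<close>

lemma rsquarefree_if_irreducible:
  assumes "irreducible P"
  shows "rsquarefree (map_poly of_rat P :: complex poly)"
  unfolding rsquarefree_roots
proof (intro allI notI, elim conjE)
  fix a assume a: "rpoly P a = 0" "poly (pderiv (map_poly of_rat P)) a = 0"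
  have "degree P \<noteq> 0"
  proof
    assume "degree P = 0"
    then obtain b where b: "P = [:b:]" using degree_eq_zeroE by blast
    then have "b \<noteq> 0" using assms by auto
    then have "P dvd 1" using b by (simp add: is_unit_poly_iff)
    then show False using irreducible_not_unit[OF assms] by blast
  qed
  have "rpoly (pderiv P) a = 0" using a(2) by (simp add: of_rat_hom.map_poly_pderiv)
  then have "P dvd pderiv P" using irreducible_dvd_if_common_root[OF assms a(1)] by blast
  moreover have "pderiv P \<noteq> 0" using \<open>degree P \<noteq> 0\<close> by (simp add: pderiv_eq_0_iff)
  ultimately have "degree P \<le> degree (pderiv P)" by (rule dvd_imp_degree_le)
  then show False using \<open>degree P \<noteq> 0\<close> by (simp add: degree_pderiv)
qed

text \<open>An embedding fixes the rational numbers, so it is determined by the image of \<open>\<alpha>\<close>.\<close>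

lemma embedding_rpoly:
  assumes P: "irreducible P" "rpoly P \<alpha> = 0" and \<sigma>: "\<sigma> \<in> embeddings (rat_adjoin \<alpha>)"
  shows "\<sigma> (rpoly p \<alpha>) = rpoly p (\<sigma> \<alpha>)"
proof -
  define K where "K = rat_adjoin \<alpha>"
  have K: "K = range (\<lambda>p. rpoly p \<alpha>)" unfolding K_def by (rule rat_adjoin_eq[OF P])
  have one: "\<sigma> 1 = 1" using \<sigma> by (simp add: embeddings_def)
  have add: "\<sigma> (x + y) = \<sigma> x + \<sigma> y" if "x \<in> K" "y \<in> K" for x y
    using \<sigma> that by (simp add: embeddings_def K_def)
  have mult: "\<sigma> (x * y) = \<sigma> x * \<sigma> y" if "x \<in> K" "y \<in> K" for x y
    using \<sigma> that by (simp add: embeddings_def K_def)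
  have rat [simp]: "of_rat q \<in> K" for q
    unfolding K_def by (intro subfield_of_rat complex_subfield_rat_adjoin)
  have int [simp]: "of_int k \<in> K" for k using rat[of "of_int k"] by simp
  have [simp]: "0 \<in> K" "1 \<in> K" using int[of 0] int[of 1] by simp_all
  have zero: "\<sigma> 0 = 0" using add[of 0 0] by simp
  have \<sigma>_int: "\<sigma> (of_int k) = of_int k" for k
  proof (induction k rule: int_induct[of _ 0])
    case (step1 i)
    then show ?case using add[of "of_int i" 1] one by simp
  next
    case (step2 i)
    have "of_int (i - 1) + 1 = (of_int i :: complex)" by simp
    then have "\<sigma> (of_int (i - 1)) + 1 = of_int i"
      using add[OF int[of "i - 1"] \<open>1 \<in> K\<close>] one step2 by metis
    then show ?case by (simp add: eq_diff_eq)
  qed (simp add: zero)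
  have \<sigma>_rat: "\<sigma> (of_rat q) = of_rat q" for q
  proof -
    obtain a b where q: "q = of_int a / of_int b" "b > 0"
      using quotient_of_div quotient_of_denom_pos by (metis surj_pair)
    then have "of_rat q * of_int b = (of_int a :: complex)" by (simp add: of_rat_divide)
    moreover from this have "\<sigma> (of_rat q) * of_int b = of_int a"
      using mult[of "of_rat q" "of_int b"] \<sigma>_int by simp
    moreover have "of_int b \<noteq> (0 :: complex)" using q(2) by simp
    ultimately show ?thesis by (metis mult_right_cancel)
  qed
  have "\<alpha> \<in> K" using rangeI[of "\<lambda>p. rpoly p \<alpha>" "[:0, 1:]"] by (simp add: K)
  show ?thesis
  proof (induction p)
    case (pCons a p)
    have "rpoly p \<alpha> \<in> K" by (simp add: K)
    moreover have "\<alpha> * rpoly p \<alpha> \<in> K"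
      using rangeI[of "\<lambda>p. rpoly p \<alpha>" "pCons 0 p"] by (simp add: K)
    ultimately show ?case using pCons \<open>\<alpha> \<in> K\<close> by (simp add: add mult \<sigma>_rat)
  qed (simp add: zero)
qed

text \<open>The embeddings correspond to the roots of \<open>P\<close> through the image of \<open>\<alpha>\<close>.\<close>

lemma field_trace_rpoly:
  assumes P: "irreducible P" "rpoly P \<alpha> = 0"
  shows "field_trace (rat_adjoin \<alpha>) (rpoly p \<alpha>) = (\<Sum>r | rpoly P r = 0. rpoly p r)"
proof -
  define K where "K = rat_adjoin \<alpha>"
  have K: "K = range (\<lambda>p. rpoly p \<alpha>)" unfolding K_def by (rule rat_adjoin_eq[OF P])
  have "\<alpha> \<in> K" using rangeI[of "\<lambda>p. rpoly p \<alpha>" "[:0, 1:]"] by (simp add: K)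
  \<comment> \<open>The inverse of \<open>\<sigma> \<mapsto> \<sigma> \<alpha>\<close>: evaluate at \<open>r\<close> any polynomial representing the element.\<close>
  define emb where "emb r = (\<lambda>x\<in>K. rpoly (SOME p. x = rpoly p \<alpha>) r)" for r
  have emb: "emb r (rpoly p \<alpha>) = rpoly p r" if "rpoly P r = 0" for p r
  proof -
    have "rpoly p \<alpha> = rpoly (SOME q. rpoly p \<alpha> = rpoly q \<alpha>) \<alpha>"
      by (rule someI[of "\<lambda>q. rpoly p \<alpha> = rpoly q \<alpha>" p]) simp
    from rpoly_eq_at_conjugate[OF P that this] show ?thesis by (simp add: emb_def K)
  qed
  have "(\<Sum>\<sigma>\<in>embeddings K. \<sigma> (rpoly p \<alpha>)) = (\<Sum>r | rpoly P r = 0. rpoly p r)"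
  proof (rule sum.reindex_bij_witness[of _ emb "\<lambda>\<sigma>. \<sigma> \<alpha>"])
    fix \<sigma> assume \<sigma>: "\<sigma> \<in> embeddings K"
    note ev = embedding_rpoly[OF P \<sigma>[unfolded K_def]]
    have "\<sigma> 0 = 0" using ev[of 0] by simp
    then show root: "\<sigma> \<alpha> \<in> {r. rpoly P r = 0}" using ev[of P] P(2) by simp
    show "emb (\<sigma> \<alpha>) = \<sigma>"
    proof (rule extensionalityI[of _ K])
      show "emb (\<sigma> \<alpha>) \<in> extensional K" by (simp add: emb_def)
      show "\<sigma> \<in> extensional K" using \<sigma> by (simp add: embeddings_def)
    next
      fix x assume "x \<in> K"
      then obtain q where "x = rpoly q \<alpha>" by (auto simp: K)
      then show "emb (\<sigma> \<alpha>) x = \<sigma> x" using emb root ev by simp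
    qed
    show "rpoly p (\<sigma> \<alpha>) = \<sigma> (rpoly p \<alpha>)" using ev by simp
  next
    fix r assume r: "r \<in> {r. rpoly P r = 0}"
    then show "emb r \<alpha> = r" using emb[of r "[:0, 1:]"] by simp
    show "emb r \<in> embeddings K"
      unfolding embeddings_def
    proof (intro CollectI conjI ballI)
      show "emb r \<in> extensional K" by (simp add: emb_def)
      show "emb r 1 = 1" using emb[of r 1] r by simp
    next
      fix x y assume "x \<in> K" "y \<in> K"
      then obtain q q' where q: "x = rpoly q \<alpha>" "y = rpoly q' \<alpha>" by (auto simp: K)
      show "emb r (x + y) = emb r x + emb r y"
        using emb[of r "q + q'"] emb[of r q] emb[of r q'] r by (simp add: q)
      show "emb r (x * y) = emb r x * emb r y"
        using emb[of r "q * q'"] emb[of r q] emb[of r q'] r by (simp add: q)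
    qed
  qed
  then show ?thesis by (simp add: field_trace_def K_def)
qed

section \<open>Determinants\<close>

text \<open>Padded with zeros to square matrices, the factors have the same product, and the first one
  then has a zero column.\<close>

lemma det_mult_eq_0_if_inner_dim_less:
  fixes A B :: "'a :: idom mat"
  assumes A: "A \<in> carrier_mat n m" and B: "B \<in> carrier_mat m n" and "m < n"
  shows "det (A * B) = 0"
proof -
  define A' where "A' = mat n n (\<lambda>(i, k). if k < m then A $$ (i, k) else 0)"
  define B' where "B' = mat n n (\<lambda>(k, j). if k < m then B $$ (k, j) else 0)"
  have A': "A' \<in> carrier_mat n n" and B': "B' \<in> carrier_mat n n" by (simp_all add: A'_def B'_def)
  have "A * B = A' * B'"
  proof (rule eq_matI)
    fix i j assume "i < dim_row (A' * B')" "j < dim_col (A' * B')"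
    then have ij: "i < n" "j < n" by (simp_all add: A'_def B'_def)
    have "(A' * B') $$ (i, j) = (\<Sum>k<n. if k < m then A $$ (i, k) * B $$ (k, j) else 0)"
      using ij by (auto simp: A'_def B'_def scalar_prod_def atLeast0LessThan intro!: sum.cong)
    also have "\<dots> = (\<Sum>k<m. A $$ (i, k) * B $$ (k, j))"
      using \<open>m < n\<close> by (intro sum.mono_neutral_cong_right) auto
    also have "\<dots> = (A * B) $$ (i, j)"
      using ij A B by (simp add: scalar_prod_def atLeast0LessThan)
    finally show "(A * B) $$ (i, j) = (A' * B') $$ (i, j)" by simp
  qed (use A B in \<open>simp_all add: A'_def B'_def\<close>)
  moreover have "det A' = 0"
    unfolding laplace_expansion_column[OF A' \<open>m < n\<close>]
    using \<open>m < n\<close> by (intro sum.neutral) (simp add: A'_def)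
  ultimately show ?thesis using det_mult[OF A' B'] by simp
qed

text \<open>Unimodular row operations replace the power \<open>x\<^sup>i\<close> by the Newton polynomial
  \<open>q\<^sub>i = (x - r\<^sub>0) \<dots> (x - r\<^bsub>i-1\<^esub>)\<close>, which vanishes at all earlier nodes; the matrix becomes
  triangular and its determinant can be read off the diagonal.\<close>

lemma det_vandermonde:
  fixes r :: "nat \<Rightarrow> 'a :: idom"
  shows "det (mat n n (\<lambda>(i, j). r j ^ i)) = (\<Prod>j<n. \<Prod>i<j. r j - r i)"
proof -
  define q where "q i = (\<Prod>l<i. [:- r l, 1:])" for i
  define V where "V = mat n n (\<lambda>(i, j). r j ^ i)"
  define T where "T = mat n n (\<lambda>(i, k). coeff (q i) k)"
  define Q where "Q = mat n n (\<lambda>(i, j). poly (q i) (r j))"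
  have deg: "degree (q i) = i" for i
    unfolding q_def by (subst degree_prod_eq_sum_degree) auto
  have lead: "coeff (q i) i = 1" for i
    using deg[of i] lead_coeff_prod[of "\<lambda>l. [:- r l, 1:]" "{..<i}"] by (simp add: q_def)
  have V: "V \<in> carrier_mat n n" and T: "T \<in> carrier_mat n n" and Q: "Q \<in> carrier_mat n n"
    by (simp_all add: V_def T_def Q_def)
  have "Q = T * V"
  proof (rule eq_matI)
    fix i j assume "i < dim_row (T * V)" "j < dim_col (T * V)"
    then have ij: "i < n" "j < n" by (simp_all add: T_def V_def)
    have "poly (q i) (r j) = (\<Sum>k\<le>i. coeff (q i) k * r j ^ k)"
      by (simp add: poly_altdef deg)
    also have "\<dots> = (\<Sum>k<n. coeff (q i) k * r j ^ k)"
      using ij deg by (intro sum.mono_neutral_left) (auto simp: coeff_eq_0)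
    finally show "Q $$ (i, j) = (T * V) $$ (i, j)"
      using ij by (simp add: Q_def T_def V_def scalar_prod_def atLeast0LessThan)
  qed (simp_all add: Q_def T_def V_def)
  moreover have "det T = 1"
  proof -
    have "det T = prod_list (diag_mat T)"
      by (rule det_lower_triangular[OF _ T]) (auto simp: T_def deg coeff_eq_0)
    also have "diag_mat T = map (\<lambda>_. 1) [0..<n]"
      by (auto simp: diag_mat_def T_def lead)
    also have "prod_list \<dots> = 1" by (induction n) auto
    finally show ?thesis .
  qed
  moreover have "det Q = (\<Prod>j<n. \<Prod>i<j. r j - r i)"
  proof -
    have "det Q = prod_list (diag_mat Q)"
    proof (rule det_upper_triangular[OF _ Q], rule upper_triangularI)
      fix i j assume "j < i" "i < dim_row Q"
      then show "Q $$ (i, j) = 0" by (auto simp: Q_def q_def poly_prod)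
    qed
    also have "\<dots> = (\<Prod>j<n. Q $$ (j, j))"
      using Q by (simp add: diag_mat_def prod.list_conv_set_nth atLeast0LessThan)
    also have "\<dots> = (\<Prod>j<n. \<Prod>i<j. r j - r i)"
      by (intro prod.cong) (auto simp: Q_def q_def poly_prod)
    finally show ?thesis .
  qed
  ultimately show ?thesis using det_mult[OF T V] by (simp add: V_def)
qed

section \<open>Monogenic polynomials\<close>

lemma poly_disc_eq_vandermonde_square:
  assumes "lead_coeff f = 1" "irreducible_over_rat f"
  obtains rs where "distinct rs" "set rs = {r. ipoly f r = 0}"
    "poly_disc f = (det (mat (length rs) (length rs) (\<lambda>(i, j). (rs ! j) ^ i)))\<^sup>2"
    "poly_disc f \<noteq> 0"
proof -
  let ?F = "map_poly of_int f :: complex poly"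
  define rs where "rs = (SOME rs. mset rs = proots ?F)"
  have rs: "mset rs = proots ?F" unfolding rs_def by (rule someI_ex) (rule ex_mset)
  have "?F \<noteq> 0" using assms(1) by auto
  have "irreducible (map_poly of_int f :: rat poly)" using assms(2) by (simp add: irreducible_over_rat_def)
  from rsquarefree_if_irreducible[OF this] have "rsquarefree ?F"
    by (simp add: map_poly_map_poly o_def)
  then have "count (mset rs) a \<le> 1" for a
    using \<open>?F \<noteq> 0\<close> unfolding rs by (metis count_proots le_numeral_extra(4) rsquarefree_def zero_le_one)
  then have "distinct rs"
    unfolding distinct_count_atmost_1
    by (metis One_nat_def count_greater_zero_iff in_multiset_in_set
        le_antisym less_eq_Suc_le not_in_iff)
  have set: "set rs = {r. ipoly f r = 0}"
    using \<open>?F \<noteq> 0\<close> rs set_count_proots by (metis set_mset_mset)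
  have "poly_disc f = (\<Prod>j<length rs. \<Prod>i<j. (rs ! i - rs ! j)\<^sup>2)"
    unfolding poly_disc_def Let_def rs_def[symmetric] using assms(1) by simp
  also have "\<dots> = (\<Prod>j<length rs. \<Prod>i<j. rs ! j - rs ! i)\<^sup>2"
    by (simp add: prod_power_distrib power2_commute)
  finally have disc: "poly_disc f = (\<Prod>j<length rs. \<Prod>i<j. rs ! j - rs ! i)\<^sup>2" .
  then have "poly_disc f \<noteq> 0"
    using \<open>distinct rs\<close> by (auto simp: nth_eq_iff_index_eq)
  then show ?thesis
    using that[of rs] \<open>distinct rs\<close> set disc det_vandermonde[of "length rs" "(!) rs"] by simp
qed

text \<open>Let \<open>E\<close> be the matrix of conjugates of an integral basis, \<open>A\<close> the integer matrix expressing
  the powers of \<open>\<alpha>\<close> in that basis, and \<open>V\<close> the Vandermonde matrix of the conjugates of \<open>\<alpha>\<close>. Then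
  \<open>V = A E\<close>, while the trace form has matrix \<open>G = E E\<^sup>T\<close>. The hypothesis \<open>det G = (det V)\<^sup>2 \<noteq> 0\<close>
  forces \<open>(det A)\<^sup>2 = 1\<close>, so the basis consists of integer combinations of powers of \<open>\<alpha>\<close>.\<close>

lemma ring_of_integers_if_monogenic_poly:
  assumes f: "monogenic_poly f" and \<alpha>: "ipoly f \<alpha> = 0"
  shows "ring_of_integers (rat_adjoin \<alpha>) = int_adjoin \<alpha>"
proof
  have monic: "lead_coeff f = 1" and irr: "irreducible_over_rat f"
    and disc: "has_field_disc (rat_adjoin \<alpha>) (poly_disc f)"
    using f \<alpha> by (auto simp: monogenic_poly_def)
  define P :: "rat poly" where "P = map_poly of_int f"
  have P: "irreducible P" "rpoly P \<alpha> = 0"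
    using irr \<alpha> by (simp_all add: P_def irreducible_over_rat_def rpoly_of_int_poly)
  have "algebraic_int \<alpha>" using \<alpha> monic algebraic_int_altdef_ipoly by blast
  then show sub: "int_adjoin \<alpha> \<subseteq> ring_of_integers (rat_adjoin \<alpha>)"
    by (rule int_adjoin_subset_ring_of_integers[OF _ P])
  obtain rs where rs: "distinct rs" "set rs = {r. rpoly P r = 0}"
    and disc_V: "poly_disc f = (det (mat (length rs) (length rs) (\<lambda>(i, j). (rs ! j) ^ i)))\<^sup>2"
    and disc_nz: "poly_disc f \<noteq> 0"
    using poly_disc_eq_vandermonde_square[OF monic irr] unfolding P_def rpoly_of_int_poly by metis
  obtain ws where ws: "integral_basis (rat_adjoin \<alpha>) ws"
    and disc_G: "poly_disc f = det (mat (length ws) (length ws)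
      (\<lambda>(i, j). field_trace (rat_adjoin \<alpha>) (ws ! i * ws ! j)))"
    using disc unfolding has_field_disc_def by blast
  define n N where "n = length rs" and "N = length ws"
  have "\<exists>p. w = rpoly p \<alpha>" if "w \<in> set ws" for w
    using ws that rat_adjoin_eq[OF P] by (auto simp: integral_basis_def ring_of_integers_def)
  then obtain p where "\<And>w. w \<in> set ws \<Longrightarrow> w = rpoly (p w) \<alpha>" by metis
  then have p: "ws ! k = rpoly (p (ws ! k)) \<alpha>" if "k < N" for k using that by (simp add: N_def)
  have combination: "\<exists>a :: nat \<Rightarrow> int. x = (\<Sum>k<N. of_int (a k) * ws ! k)"
    if "x \<in> ring_of_integers (rat_adjoin \<alpha>)" for x
    using ws that unfolding integral_basis_def N_def by blast
  have "\<alpha> ^ i \<in> ring_of_integers (rat_adjoin \<alpha>)" for i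
    using sub int_adjoin_power[OF int_adjoin_generator] by blast
  then have "\<exists>a :: nat \<Rightarrow> int. \<alpha> ^ i = (\<Sum>k<N. of_int (a k) * ws ! k)" for i
    using combination by blast
  then obtain a :: "nat \<Rightarrow> nat \<Rightarrow> int"
    where a: "\<And>i. \<alpha> ^ i = (\<Sum>k<N. of_int (a i k) * ws ! k)" by metis
  define M where "M = mat n N (\<lambda>(i, k). a i k)"
  define A :: "complex mat" where "A = map_mat of_int M"
  define E where "E = mat N n (\<lambda>(k, j). rpoly (p (ws ! k)) (rs ! j))"
  define V where "V = mat n n (\<lambda>(i, j). (rs ! j) ^ i)"
  define G where "G = mat N N (\<lambda>(i, j). field_trace (rat_adjoin \<alpha>) (ws ! i * ws ! j))"
  have M: "M \<in> carrier_mat n N" and A: "A \<in> carrier_mat n N" and E: "E \<in> carrier_mat N n"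
    and V: "V \<in> carrier_mat n n" and G: "G \<in> carrier_mat N N"
    by (simp_all add: M_def A_def E_def V_def G_def)
  have V_eq: "V = A * E"
  proof (rule eq_matI)
    fix i j assume "i < dim_row (A * E)" "j < dim_col (A * E)"
    then have ij: "i < n" "j < n" using A E by auto
    \<comment> \<open>A polynomial form of the relation expressing \<open>\<alpha>\<^sup>i\<close> in the basis; as an identity between
        values at \<open>\<alpha>\<close> it persists at every root.\<close>
    define s where "s = (\<Sum>k<N. [:of_int (a i k):] * p (ws ! k))"
    have s: "rpoly s x = (\<Sum>k<N. of_int (a i k) * rpoly (p (ws ! k)) x)" for x
      by (simp add: s_def rpoly_sum)
    have "rpoly s \<alpha> = (\<Sum>k<N. of_int (a i k) * ws ! k)"
      unfolding s by (intro sum.cong refl) (use p in simp)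
    also have "\<dots> = rpoly (monom 1 i) \<alpha>" by (simp only: rpoly_simps a)
    finally have eq: "rpoly (monom 1 i) \<alpha> = rpoly s \<alpha>" by (rule sym)
    have "rs ! j \<in> set rs" using ij(2) by (simp add: n_def)
    then have root: "rpoly P (rs ! j) = 0" unfolding rs(2) by simp
    from rpoly_eq_at_conjugate[OF P root eq] have "(rs ! j) ^ i = rpoly s (rs ! j)"
      by (simp only: rpoly_simps)
    then show "V $$ (i, j) = (A * E) $$ (i, j)"
      using ij by (simp add: s V_def A_def M_def E_def scalar_prod_def atLeast0LessThan)
  qed (use A E V in auto)
  have G_eq: "G = E * transpose_mat E"
  proof (rule eq_matI)
    fix i j assume "i < dim_row (E * transpose_mat E)" "j < dim_col (E * transpose_mat E)"
    then have ij: "i < N" "j < N" using E by auto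
    have "field_trace (rat_adjoin \<alpha>) (ws ! i * ws ! j) =
        field_trace (rat_adjoin \<alpha>) (rpoly (p (ws ! i) * p (ws ! j)) \<alpha>)"
      using p ij by simp
    also have "\<dots> = (\<Sum>r\<in>set rs. rpoly (p (ws ! i)) r * rpoly (p (ws ! j)) r)"
      unfolding field_trace_rpoly[OF P] rs(2) by simp
    also have "\<dots> = (\<Sum>l<n. rpoly (p (ws ! i)) (rs ! l) * rpoly (p (ws ! j)) (rs ! l))"
      unfolding n_def
      by (rule sum.reindex_bij_betw[symmetric, OF bij_betw_nth]) (use rs(1) in auto)
    finally show "G $$ (i, j) = (E * transpose_mat E) $$ (i, j)"
      using ij by (simp add: G_def E_def scalar_prod_def atLeast0LessThan)
  qed (use E G in auto)
  have det_V: "(det V)\<^sup>2 = poly_disc f" using disc_V by (simp add: V_def n_def)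
  have det_G: "det G = poly_disc f" using disc_G by (simp add: G_def N_def)
  \<comment> \<open>If the sizes differed, one of \<open>G = E E\<^sup>T\<close> and \<open>V = A E\<close> would factor through a smaller
      dimension and be singular.\<close>
  have "N = n"
  proof (rule antisym; rule ccontr)
    assume "\<not> N \<le> n"
    then have "det G = 0"
      unfolding G_eq using E by (intro det_mult_eq_0_if_inner_dim_less) auto
    then show False using det_G disc_nz by simp
  next
    assume "\<not> n \<le> N"
    then have "det V = 0"
      unfolding V_eq using A E by (intro det_mult_eq_0_if_inner_dim_less) auto
    then show False using det_V disc_nz by simp
  qed
  note M = M[unfolded \<open>N = n\<close>] and A = A[unfolded \<open>N = n\<close>] and E = E[unfolded \<open>N = n\<close>]
  have "det G = (det E)\<^sup>2"
    unfolding G_eq using det_mult[OF E, of "transpose_mat E"] det_transpose[OF E] E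
    by (simp add: power2_eq_square)
  moreover have "det V = det A * det E" unfolding V_eq by (rule det_mult[OF A E])
  ultimately have "(det A)\<^sup>2 * poly_disc f = poly_disc f"
    using det_V det_G by (simp add: power_mult_distrib)
  then have "(det A)\<^sup>2 = 1" using disc_nz by simp
  then have "of_int ((det M)\<^sup>2) = (1 :: complex)" by (simp add: A_def of_int_hom.hom_det)
  then have unimod: "det M * det M = 1" by (simp only: of_int_eq_1_iff power2_eq_square)
  \<comment> \<open>As \<open>det M = \<plusminus>1\<close>, the adjugate matrix is the inverse of \<open>M\<close> up to sign and has integer
      entries.\<close>
  define B where "B = adj_mat M"
  have B: "B \<in> carrier_mat n n" "B * M = det M \<cdot>\<^sub>m 1\<^sub>m n" using adj_mat[OF M] by (simp_all add: B_def)
  have w: "ws ! k \<in> int_adjoin \<alpha>" if k: "k < n" for k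
  proof -
    have "(\<Sum>i<n. of_int (B $$ (k, i)) * \<alpha> ^ i) =
        (\<Sum>i<n. \<Sum>l<n. of_int (B $$ (k, i) * M $$ (i, l)) * ws ! l)"
    proof (rule sum.cong[OF refl])
      fix i assume "i \<in> {..<n}"
      then have entry: "M $$ (i, l) = a i l" if "l < n" for l using that by (simp add: M_def \<open>N = n\<close>)
      have "of_int (B $$ (k, i)) * \<alpha> ^ i = (\<Sum>l<n. of_int (B $$ (k, i)) * (of_int (a i l) * ws ! l))"
        unfolding a[of i] \<open>N = n\<close> by (rule sum_distrib_left)
      also have "\<dots> = (\<Sum>l<n. of_int (B $$ (k, i) * M $$ (i, l)) * ws ! l)"
        by (rule sum.cong[OF refl]) (simp add: entry)
      finally show "of_int (B $$ (k, i)) * \<alpha> ^ i =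
        (\<Sum>l<n. of_int (B $$ (k, i) * M $$ (i, l)) * ws ! l)" .
    qed
    also have "\<dots> = (\<Sum>l<n. \<Sum>i<n. of_int (B $$ (k, i) * M $$ (i, l)) * ws ! l)"
      by (rule sum.swap)
    also have "\<dots> = (\<Sum>l<n. of_int (\<Sum>i<n. B $$ (k, i) * M $$ (i, l)) * ws ! l)"
      unfolding of_int_sum sum_distrib_right by (rule refl)
    also have "\<dots> = (\<Sum>l<n. of_int ((B * M) $$ (k, l)) * ws ! l)"
      using k B(1) M by (intro sum.cong refl) (simp add: scalar_prod_def atLeast0LessThan)
    also have "\<dots> = (\<Sum>l<n. if l = k then of_int (det M) * ws ! l else 0)"
      unfolding B(2) using k by (intro sum.cong refl) auto
    also have "\<dots> = of_int (det M) * ws ! k" using k by simp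
    finally have "of_int (det M) * (\<Sum>i<n. of_int (B $$ (k, i)) * \<alpha> ^ i) =
        of_int (det M * det M) * ws ! k" by simp
    then have "ws ! k = of_int (det M) * (\<Sum>i<n. of_int (B $$ (k, i)) * \<alpha> ^ i)"
      using unimod by simp
    also have "\<dots> \<in> int_adjoin \<alpha>"
      by (intro int_adjoin_closed int_adjoin_sum int_adjoin_of_int int_adjoin_power int_adjoin_generator)
    finally show ?thesis .
  qed
  show "ring_of_integers (rat_adjoin \<alpha>) \<subseteq> int_adjoin \<alpha>"
  proof
    fix x assume "x \<in> ring_of_integers (rat_adjoin \<alpha>)"
    then obtain c :: "nat \<Rightarrow> int" where "x = (\<Sum>k<n. of_int (c k) * ws ! k)"
      using combination \<open>N = n\<close> by blast
    then show "x \<in> int_adjoin \<alpha>"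
      using w by (auto intro!: int_adjoin_sum int_adjoin_closed)
  qed
qed

section \<open>Divisibility in a monogenic order\<close>

text \<open>Pseudo-division by a monic polynomial is division with remainder over the integers. Over the
  rationals \<open>f\<close> divides the remainder, whose degree is too small.\<close>

lemma dvd_if_common_root_int:
  assumes f: "lead_coeff f = 1" "irreducible_over_rat f" "ipoly f \<alpha> = 0" and p: "ipoly p \<alpha> = 0"
  shows "f dvd p"
proof -
  define q r where "q = fst (pseudo_divmod p f)" and "r = snd (pseudo_divmod p f)"
  have "f \<noteq> 0" using f(1) by auto
  then have p_eq: "p = f * q + r" and r: "r = 0 \<or> degree r < degree f"
    using pseudo_divmod[of f p q r] f(1) by (simp_all add: q_def r_def)
  have "ipoly r \<alpha> = 0" using p f(3) unfolding p_eq by (simp add: hom_distribs)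
  then have "map_poly of_int f dvd (map_poly of_int r :: rat poly)"
    using f(2,3) unfolding irreducible_over_rat_def
    by (intro irreducible_dvd_if_common_root[of _ \<alpha>]) (simp_all add: rpoly_of_int_poly)
  then have "r = 0"
    using r dvd_imp_degree_le[of "map_poly of_int f" "map_poly of_int r :: rat poly"] by (cases "r = 0") auto
  then show ?thesis using p_eq by simp
qed

lemma squarefree_dvd_power2D:
  fixes a b :: int
  assumes "squarefree a" "a dvd b\<^sup>2"
  shows "a dvd b"
proof -
  define d where "d = gcd a b"
  have "a \<noteq> 0" using assms(1) by auto
  then have "d \<noteq> 0" by (simp add: d_def)
  obtain a' b' where a': "a = a' * d" and b': "b = b' * d" and cop: "coprime a' b'"
    using gcd_coprime_exists[of a b] \<open>a \<noteq> 0\<close> unfolding d_def by auto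
  have "a' * d dvd (b'\<^sup>2 * d) * d" using assms(2) unfolding a' b' by (simp add: power2_eq_square mult_ac)
  then have "a' dvd b'\<^sup>2 * d" using \<open>d \<noteq> 0\<close> by simp
  moreover have "coprime a' (b'\<^sup>2)" using cop by simp
  ultimately have "a' dvd d" using coprime_dvd_mult_right_iff by blast
  then have "a'\<^sup>2 dvd a" unfolding a' by (simp add: power2_eq_square mult_dvd_mono)
  then have "a' dvd 1" using assms(1) squarefreeD by blast
  then have "a dvd d" unfolding a' by (subst mult_unit_dvd_iff') auto
  then show ?thesis by (simp add: d_def)
qed

text \<open>Evaluation at \<open>a\<close> identifies \<open>\<int>[\<alpha>]/(\<alpha> - a)\<close> with the integers modulo \<open>f(a)\<close>, a ring
  without nilpotent elements. On representatives: if \<open>g\<close> represents \<open>w\<close>, then \<open>f(a)\<close> divides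
  \<open>g(a)\<^sup>2\<close>, hence \<open>g(a)\<close>, so a multiple of \<open>f\<close> can be subtracted from \<open>g\<close> to make it vanish at
  \<open>a\<close>.\<close>

lemma linear_factor_dvd_if_dvd_square:
  assumes f: "lead_coeff f = 1" "irreducible_over_rat f" "ipoly f \<alpha> = 0"
    and sqf: "squarefree (poly f a)"
    and w: "w \<in> int_adjoin \<alpha>" "z \<in> int_adjoin \<alpha>" "w\<^sup>2 = (\<alpha> - of_int a) * z"
  obtains y where "y \<in> int_adjoin \<alpha>" "w = (\<alpha> - of_int a) * y"
proof -
  obtain g h where g: "w = ipoly g \<alpha>" and h: "z = ipoly h \<alpha>"
    using w by (auto simp: int_adjoin_def)
  have "ipoly (g\<^sup>2 - [:- a, 1:] * h) \<alpha> = 0"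
    using w(3) by (simp add: hom_distribs g h algebra_simps)
  then obtain k where k: "g\<^sup>2 - [:- a, 1:] * h = f * k"
    using dvd_if_common_root_int[OF f] by blast
  have "(poly g a)\<^sup>2 = poly (g\<^sup>2 - [:- a, 1:] * h) a" by simp
  also have "\<dots> = poly f a * poly k a" unfolding k by simp
  finally have "poly f a dvd poly g a" using squarefree_dvd_power2D[OF sqf] by simp
  then obtain t where "poly g a = poly f a * t" by blast
  then have "poly (g - Polynomial.smult t f) a = 0" by simp
  then obtain y where "g - Polynomial.smult t f = [:- a, 1:] * y"
    unfolding poly_eq_0_iff_dvd by blast
  then have "ipoly (g - Polynomial.smult t f) \<alpha> = ipoly ([:- a, 1:] * y) \<alpha>" by simp
  then have "w = (\<alpha> - of_int a) * ipoly y \<alpha>" using f(3) by (simp add: hom_distribs g algebra_simps)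
  then show ?thesis using that by blast
qed

text \<open>Because \<open>f(a) - f\<close> vanishes at \<open>a\<close>.\<close>

lemma linear_factor_dvd_value:
  assumes "ipoly f \<alpha> = 0"
  obtains e where "e \<in> int_adjoin \<alpha>" "of_int (poly f a) = (\<alpha> - of_int a) * e"
proof -
  have "poly ([:poly f a:] - f) a = 0" by simp
  then obtain e where "[:poly f a:] - f = [:- a, 1:] * e"
    unfolding poly_eq_0_iff_dvd by blast
  then have "ipoly ([:poly f a:] - f) \<alpha> = ipoly ([:- a, 1:] * e) \<alpha>" by simp
  then have "of_int (poly f a) = (\<alpha> - of_int a) * ipoly e \<alpha>"
    using assms by (simp add: hom_distribs algebra_simps)
  then show ?thesis using that by blast
qed

text \<open>The two linear factors are handled separately. They are comaximal in \<open>\<int>[\<alpha>]\<close>, since they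
  divide the integers \<open>f(a)\<close> and \<open>f(b)\<close>, which are coprime because their product is
  squarefree; so their product divides \<open>w\<close> as well.\<close>

lemma quadratic_dvd_if_dvd_square:
  assumes f: "lead_coeff f = 1" "irreducible_over_rat f" "ipoly f \<alpha> = 0"
    and sqf: "squarefree (poly f a * poly f b)"
    and w: "w \<in> int_adjoin \<alpha>" "z \<in> int_adjoin \<alpha>"
      "w\<^sup>2 = (\<alpha> - of_int a) * (\<alpha> - of_int b) * z"
  obtains y where "y \<in> int_adjoin \<alpha>" "w = (\<alpha> - of_int a) * (\<alpha> - of_int b) * y"
proof -
  have sqf': "squarefree (poly f a)" "squarefree (poly f b)"
    using squarefree_multD[OF sqf] by auto
  have lin: "\<alpha> - of_int k \<in> int_adjoin \<alpha>" for k by (intro int_adjoin_closed) auto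
  obtain y1 where y1: "y1 \<in> int_adjoin \<alpha>" "w = (\<alpha> - of_int a) * y1"
    by (rule linear_factor_dvd_if_dvd_square[OF f sqf'(1) w(1), of "(\<alpha> - of_int b) * z"])
      (use w lin in \<open>auto intro: int_adjoin_closed simp: mult_ac\<close>)
  obtain y2 where y2: "y2 \<in> int_adjoin \<alpha>" "w = (\<alpha> - of_int b) * y2"
    by (rule linear_factor_dvd_if_dvd_square[OF f sqf'(2) w(1), of "(\<alpha> - of_int a) * z"])
      (use w lin in \<open>auto intro: int_adjoin_closed simp: mult_ac\<close>)
  obtain e1 where e1: "e1 \<in> int_adjoin \<alpha>" "of_int (poly f a) = (\<alpha> - of_int a) * e1"
    using linear_factor_dvd_value[OF f(3)] by blast
  obtain e2 where e2: "e2 \<in> int_adjoin \<alpha>" "of_int (poly f b) = (\<alpha> - of_int b) * e2"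
    using linear_factor_dvd_value[OF f(3)] by blast
  have "(gcd (poly f a) (poly f b))\<^sup>2 dvd poly f a * poly f b"
    by (simp add: power2_eq_square mult_dvd_mono)
  then have "is_unit (gcd (poly f a) (poly f b))" by (rule squarefreeD[OF sqf])
  then have "gcd (poly f a) (poly f b) = 1" by (simp only: is_unit_gcd_iff)
  then obtain k l where "k * poly f a + l * poly f b = 1"
    by (metis bezout_int)
  then have "(of_int (k * poly f a + l * poly f b) :: complex) = 1" by simp
  then have one: "of_int k * ((\<alpha> - of_int a) * e1) + of_int l * ((\<alpha> - of_int b) * e2) = 1"
    using e1(2) e2(2) by simp
  have "w = of_int k * ((\<alpha> - of_int a) * e1) * w + of_int l * ((\<alpha> - of_int b) * e2) * w"
    unfolding distrib_right[symmetric] one by simp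
  also have "\<dots> = of_int k * ((\<alpha> - of_int a) * e1) * ((\<alpha> - of_int b) * y2)
      + of_int l * ((\<alpha> - of_int b) * e2) * ((\<alpha> - of_int a) * y1)"
    using y1(2) y2(2) by simp
  also have "\<dots> = (\<alpha> - of_int a) * (\<alpha> - of_int b) * (of_int k * (e1 * y2) + of_int l * (e2 * y1))"
    by (simp only: distrib_left mult_ac)
  finally show ?thesis
    using that[of "of_int k * (e1 * y2) + of_int l * (e2 * y1)"] e1(1) e2(1) y1(1) y2(1)
    by (auto intro!: int_adjoin_closed)
qed

section \<open>The reciprocal lift\<close>

text \<open>The \<open>i\<close>-th summand has degree at most \<open>n + i\<close>, so only the one with \<open>i = n\<close> contributes in
  degree \<open>2 n\<close>.\<close>

lemma monic_reciprocal_lift: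
  assumes "lead_coeff f = 1"
  shows "lead_coeff (reciprocal_lift c f) = 1"
proof -
  define n where "n = degree f"
  define t where "t i = Polynomial.smult (coeff f i) (monom 1 (n - i) * [:1, c, 1:] ^ i)" for i
  have F: "reciprocal_lift c f = (\<Sum>i\<le>n. t i)" by (simp add: reciprocal_lift_def t_def n_def)
  have deg: "degree (t i) \<le> n + i" if "i \<le> n" for i
  proof -
    have "degree (t i) \<le> degree (monom (1 :: int) (n - i) * [:1, c, 1:] ^ i)"
      unfolding t_def by (rule degree_smult_le)
    also have "\<dots> \<le> (n - i) + 2 * i"
      by (intro order_trans[OF degree_mult_le] add_mono) (auto simp: degree_monom_eq degree_power_eq)
    finally show ?thesis using that by simp
  qed
  have "degree (\<Sum>i\<le>n. t i) \<le> 2 * n"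
    using deg by (intro degree_sum_le) fastforce+
  moreover have "coeff (\<Sum>i\<le>n. t i) (2 * n) = 1"
  proof -
    have "coeff (\<Sum>i\<le>n. t i) (2 * n) = (\<Sum>i\<le>n. coeff (t i) (2 * n))" by (simp add: coeff_sum)
    also have "\<dots> = (\<Sum>i\<in>{n}. coeff (t i) (2 * n))"
    proof (intro sum.mono_neutral_right ballI)
      fix i assume "i \<in> {..n} - {n}"
      then have "degree (t i) < 2 * n" using deg[of i] by simp
      then show "coeff (t i) (2 * n) = 0" by (rule coeff_eq_0)
    qed auto
    also have "\<dots> = lead_coeff ([:1, c, 1:] ^ n)"
      using assms by (simp add: t_def n_def degree_power_eq mult_2 mult_2_right)
    also have "\<dots> = 1" by (simp add: lead_coeff_power)
    finally show ?thesis .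
  qed
  ultimately have "degree (\<Sum>i\<le>n. t i) = 2 * n"
    by (intro antisym le_degree) auto
  then show ?thesis using \<open>coeff (\<Sum>i\<le>n. t i) (2 * n) = 1\<close> by (simp add: F)
qed

lemma reciprocal_lift_0:
  assumes "lead_coeff f = 1"
  shows "coeff (reciprocal_lift c f) 0 = 1"
proof -
  have "coeff (reciprocal_lift c f) 0 = (\<Sum>i\<le>degree f. coeff f i * 0 ^ (degree f - i))"
    unfolding reciprocal_lift_def by (simp flip: poly_0_coeff_0 add: poly_sum poly_monom)
  also have "\<dots> = (\<Sum>i\<in>{degree f}. coeff f i * 0 ^ (degree f - i))"
    by (intro sum.mono_neutral_right) auto
  also have "\<dots> = 1" using assms by simp
  finally show ?thesis .
qed

text \<open>If \<open>F = 1 + x G\<close>, then \<open>1/\<beta> = - G(\<beta>)\<close>.\<close>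

lemma inverse_root_mem_int_adjoin:
  assumes "coeff F 0 = 1" "ipoly F \<beta> = 0"
  shows "1 / \<beta> \<in> int_adjoin \<beta>" "\<beta> \<noteq> 0"
proof -
  obtain G where F: "F = pCons 1 G" using assms(1) by (cases F) auto
  then have eq: "1 + \<beta> * ipoly G \<beta> = 0" using assms(2) by (simp add: hom_distribs)
  then show "\<beta> \<noteq> 0" by auto
  then have "1 / \<beta> = ipoly (- G) \<beta>" using eq by (simp add: hom_distribs field_simps eq_neg_iff_add_eq_0)
  then show "1 / \<beta> \<in> int_adjoin \<beta>" by simp
qed

text \<open>As \<open>y\<^sup>2 = (y + 1/y) y - 1\<close>, every polynomial in \<open>y\<close> reduces to a linear one over the
  polynomials in \<open>y + 1/y\<close>. The coefficients do not depend on \<open>y\<close>, so the same ones serve for a root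
  and for its inverse, which share the value of \<open>y + 1/y\<close>.\<close>

lemma rpoly_reciprocal_decomposition:
  obtains u v where
    "\<And>y. y \<noteq> 0 \<Longrightarrow> rpoly p y = rpoly u (y + 1 / y) + rpoly v (y + 1 / y) * y"
proof -
  have "\<exists>u v. \<forall>y. y \<noteq> 0 \<longrightarrow> rpoly p y = rpoly u (y + 1 / y) + rpoly v (y + 1 / y) * y"
  proof (induction p)
    case 0
    show ?case by (intro exI[of _ 0]) simp
  next
    case (pCons a p)
    then obtain u v
      where uv: "\<And>y. y \<noteq> 0 \<Longrightarrow> rpoly p y = rpoly u (y + 1 / y) + rpoly v (y + 1 / y) * y" by blast
    have "rpoly (pCons a p) y =
        rpoly ([:a:] - v) (y + 1 / y) + rpoly (u + [:0, 1:] * v) (y + 1 / y) * y" if "y \<noteq> 0" for y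
    proof -
      have step: "of_rat a + y * (A + B * y) = of_rat a - B + (A + s * B) * y"
        if "s * y = y * y + 1" for A B s
      proof -
        have "(A + s * B) * y = A * y + B * (s * y)" by (simp add: algebra_simps)
        then show ?thesis unfolding that by (simp add: algebra_simps)
      qed
      have "(y + 1 / y) * y = y * y + 1" using that by (simp add: distrib_right)
      from step[OF this] show ?thesis by (simp add: uv that)
    qed
    then show ?case by blast
  qed
  then show ?thesis using that by blast
qed

theorem theorem1p3:
  fixes f F :: "int poly" and c :: int and \<beta> :: complex
  assumes "lead_coeff f = 1"
    and "irreducible_over_rat f"
    and "monogenic_poly f"
    and "F = reciprocal_lift c f"
    and "poly (map_poly of_int F) \<beta> = 0"
    and "squarefree (poly f (c + 2) * poly f (c - 2))"
    and "irreducible_over_rat F"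
  shows "ring_of_integers (rat_adjoin \<beta>) = int_adjoin \<beta> \<and> monogenic_field (rat_adjoin \<beta>)"
proof -
  define P Q :: "rat poly" where "P = map_poly of_int f" and "Q = map_poly of_int F"
  define \<alpha> where "\<alpha> = \<beta> + 1 / \<beta> + of_int c"
  have inv\<beta>: "1 / \<beta> \<in> int_adjoin \<beta>" and "\<beta> \<noteq> 0"
    using inverse_root_mem_int_adjoin[of F \<beta>] reciprocal_lift_0 assms(1,4,5) by auto
  have f\<alpha>: "ipoly f \<alpha> = 0"
    using poly_reciprocal_lift[OF \<open>\<beta> \<noteq> 0\<close>, of c f] assms(4,5) \<open>\<beta> \<noteq> 0\<close> by (simp add: \<alpha>_def)
  have F_inv: "ipoly F (1 / \<beta>) = 0"
    using poly_reciprocal_lift[of "1 / \<beta>" c f] assms(4) \<open>\<beta> \<noteq> 0\<close> f\<alpha>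
    by (simp add: \<alpha>_def add.commute)
  have P: "irreducible P" "rpoly P \<alpha> = 0"
    using assms(2) f\<alpha> by (simp_all add: P_def irreducible_over_rat_def rpoly_of_int_poly)
  have Q: "irreducible Q" "rpoly Q \<beta> = 0" "rpoly Q (1 / \<beta>) = 0"
    using assms(5,7) F_inv by (simp_all add: Q_def irreducible_over_rat_def rpoly_of_int_poly)
  have "lead_coeff F = 1" using monic_reciprocal_lift assms(1,4) by simp
  then have "algebraic_int \<beta>" using assms(5) algebraic_int_altdef_ipoly by blast
  have "algebraic_int \<alpha>" using f\<alpha> assms(1) algebraic_int_altdef_ipoly by blast
  have "\<alpha> \<in> int_adjoin \<beta>"
    unfolding \<alpha>_def using inv\<beta> by (intro int_adjoin_closed) auto
  then have \<alpha>\<beta>: "int_adjoin \<alpha> \<subseteq> int_adjoin \<beta>" by (rule int_adjoin_subset)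
  have OK: "y \<in> int_adjoin \<alpha>" if "y = rpoly p \<alpha>" "algebraic_int y" for y p
    using ring_of_integers_if_monogenic_poly[OF assms(3) f\<alpha>] rat_adjoin_eq[OF P] that
    by (auto simp: ring_of_integers_def)
  have \<alpha>_ne: "\<alpha> \<noteq> of_int k" if "poly f k \<noteq> 0" for k
    using f\<alpha> that by (metis of_int_eq_0_iff of_int_hom.poly_map_poly)
  define d where "d = \<beta> - 1 / \<beta>"
  have d2: "d\<^sup>2 = (\<alpha> - of_int (c + 2)) * (\<alpha> - of_int (c - 2))"
  proof -
    have "(b - i)\<^sup>2 = (b + i + e - (e + 2)) * (b + i + e - (e - 2))"
      if "b * i = 1" for b i e :: complex
    proof -
      have "(b + i + e - (e + 2)) * (b + i + e - (e - 2)) - (b - i)\<^sup>2 = 4 * (b * i) - 4"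
        by (simp add: power2_eq_square algebra_simps)
      then show ?thesis using that by simp
    qed
    from this[of \<beta> "1 / \<beta>" "of_int c"] show ?thesis
      using \<open>\<beta> \<noteq> 0\<close> by (simp add: d_def \<alpha>_def)
  qed
  have "poly f (c + 2) \<noteq> 0" "poly f (c - 2) \<noteq> 0" using assms(6) by auto
  then have "d \<noteq> 0" using d2 \<alpha>_ne[of "c + 2"] \<alpha>_ne[of "c - 2"] by auto
  have "x \<in> int_adjoin \<beta>" if x: "x \<in> ring_of_integers (rat_adjoin \<beta>)" for x
  proof -
    from x obtain p where p: "x = rpoly p \<beta>" and "algebraic_int x"
      using rat_adjoin_eq[OF Q(1,2)] by (auto simp: ring_of_integers_def)
    \<comment> \<open>The conjugate of \<open>x\<close> over \<open>\<rat>(\<alpha>)\<close>. It satisfies the same monic equation, because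
        \<open>\<beta>\<close> and \<open>1/\<beta>\<close> are roots of the same irreducible polynomial.\<close>
    define x' where "x' = rpoly p (1 / \<beta>)"
    have "algebraic_int x'"
    proof -
      obtain q where q: "lead_coeff q = 1" "ipoly q x = 0"
        using \<open>algebraic_int x\<close> algebraic_int_altdef_ipoly by blast
      have "rpoly (map_poly of_int q \<circ>\<^sub>p p) \<beta> = rpoly 0 \<beta>"
        using q(2) by (simp add: rpoly_pcompose rpoly_of_int_poly p)
      from rpoly_eq_at_conjugate[OF Q this] have "ipoly q x' = 0"
        by (simp add: rpoly_pcompose rpoly_of_int_poly x'_def)
      then show ?thesis using q(1) algebraic_int_altdef_ipoly by blast
    qed
    obtain u v where uv: "\<And>y. y \<noteq> 0 \<Longrightarrow> rpoly p y = rpoly u (y + 1 / y) + rpoly v (y + 1 / y) * y"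
      using rpoly_reciprocal_decomposition by blast
    \<comment> \<open>The shift by \<open>c\<close> turns polynomials in \<open>\<beta> + 1/\<beta>\<close> into polynomials in \<open>\<alpha>\<close>.\<close>
    define u' v' where "u' = u \<circ>\<^sub>p [:- of_int c, 1:]" and "v' = v \<circ>\<^sub>p [:- of_int c, 1:]"
    define U V where "U = rpoly u' \<alpha>" and "V = rpoly v' \<alpha>"
    have x_eq: "x = U + V * \<beta>"
      using uv[OF \<open>\<beta> \<noteq> 0\<close>] by (simp add: p U_def V_def u'_def v'_def rpoly_pcompose \<alpha>_def of_rat_minus)
    have x'_eq: "x' = U + V * (1 / \<beta>)"
      using uv[of "1 / \<beta>"] \<open>\<beta> \<noteq> 0\<close>
      by (simp add: x'_def U_def V_def u'_def v'_def rpoly_pcompose \<alpha>_def of_rat_minus add.commute)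
    have diff: "x - x' = V * d" by (simp add: x_eq x'_eq d_def algebra_simps)
    define D :: "rat poly" where "D = [:- of_int (c + 2), 1:] * [:- of_int (c - 2), 1:]"
    have D: "rpoly D \<alpha> = d\<^sup>2" unfolding d2 D_def rpoly_simps of_rat_minus of_rat_of_int_eq by (simp add: algebra_simps)
    have "algebraic_int d"
      unfolding d_def using algebraic_int_ipoly[OF \<open>algebraic_int \<beta>\<close>] inv\<beta> \<open>algebraic_int \<beta>\<close>
      by (auto simp: int_adjoin_def intro!: algebraic_int_diff)
    have alg_diff: "algebraic_int (x - x')"
      using \<open>algebraic_int x\<close> \<open>algebraic_int x'\<close> by (rule algebraic_int_diff)
    have "V * d\<^sup>2 = (x - x') * d" by (simp add: diff power2_eq_square)
    then have "algebraic_int (V * d\<^sup>2)" using alg_diff \<open>algebraic_int d\<close> algebraic_int_mult by simp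
    then have w: "V * d\<^sup>2 \<in> int_adjoin \<alpha>" by (intro OK[of _ "v' * D"]) (simp_all add: V_def D)
    have "V\<^sup>2 * d\<^sup>2 = (x - x') * (x - x')" by (simp add: diff power2_eq_square)
    then have "algebraic_int (V\<^sup>2 * d\<^sup>2)" using alg_diff algebraic_int_mult by simp
    then have z: "V\<^sup>2 * d\<^sup>2 \<in> int_adjoin \<alpha>"
      by (intro OK[of _ "v' * v' * D"]) (simp_all add: V_def D power2_eq_square)
    have "(V * d\<^sup>2)\<^sup>2 = (\<alpha> - of_int (c + 2)) * (\<alpha> - of_int (c - 2)) * (V\<^sup>2 * d\<^sup>2)"
      unfolding d2[symmetric] by (simp add: power2_eq_square)
    from quadratic_dvd_if_dvd_square[OF assms(1,2) f\<alpha> assms(6) w z this]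
    obtain y where y: "y \<in> int_adjoin \<alpha>" "V * d\<^sup>2 = d\<^sup>2 * y" unfolding d2[symmetric] by blast
    then have V: "V \<in> int_adjoin \<alpha>" using \<open>d \<noteq> 0\<close> by simp
    then have "algebraic_int V" using \<open>algebraic_int \<alpha>\<close> algebraic_int_ipoly by (auto simp: int_adjoin_def)
    have "U = x - V * \<beta>" by (simp add: x_eq)
    then have "algebraic_int U"
      using \<open>algebraic_int x\<close> \<open>algebraic_int V\<close> \<open>algebraic_int \<beta>\<close>
      by (auto intro!: algebraic_int_diff algebraic_int_mult)
    then have U: "U \<in> int_adjoin \<alpha>" by (intro OK[of _ u']) (simp_all add: U_def)
    show ?thesis
      unfolding x_eq using U V \<alpha>\<beta> by (intro int_adjoin_closed) auto
  qed
  then have ring: "ring_of_integers (rat_adjoin \<beta>) = int_adjoin \<beta>"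
    using int_adjoin_subset_ring_of_integers[OF \<open>algebraic_int \<beta>\<close> Q(1,2)] by blast
  then show ?thesis
    using number_field_rat_adjoin[OF Q(1,2)] unfolding monogenic_field_def by blast
qed

end
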